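(* As $k\to\infty$ (over positive integers $k$), $$T^A(k,k)-\left(\left(\frac{k}{2}+\frac{\pi}{16}-\frac{\sqrt{\pi k}}{4}\right)\left(\ln k + \ln 4 + \gamma\right)+ \frac{3\pi}{16}-\frac{\sqrt{\pi k}}{4}-\frac{1}{4}\right) \to 0,$$ where $\gamma = 0.5772\dots$ is the Euler--Mascheroni constant.
   Context: Mabinogion urn model: an urn contains white and black balls. At each time $1,2,3,\dots$ one ball is drawn uniformly at random from the urn, independently of previous selections, its color is observed and it is returned. If the drawn ball is white, one black ball is replaced by a white one; if it is black, one white ball is replaced by a black one. So from a state with $w>0$ white and $b>0$ black balls, a draw leads to $(w+1,b-1)$ with probability $\frac{w}{w+b}$ and to $(w-1,b+1)$ with probability $\frac{b}{w+b}$. The process stops when all remaining balls are of the same color. Policy A: at time $0$ and immediately after each draw, if the number of white balls is greater than or equal to the number of black balls, immediately reduce (by permanently removing white balls) the number of white balls to one less than the number of black balls; otherwise do nothing. The process run under Policy A is the A-controlled M-process; removals take no time. $T^A(w,b)$ denotes the expected time to absorption (expected number of draws until all remaining balls are of the same color) in the A-controlled M-process started with $w$ white and $b$ black balls (Policy A being applied already at time $0$). *)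

theory Defs
  imports "HOL-Probability.Probability"
begin

text \<open>A state \<open>(w, b)\<close> consists of \<open>w\<close> white and \<open>b\<close> black balls.\<close>

fun monochromatic :: "nat \<times> nat \<Rightarrow> bool" where
  "monochromatic (w, b) \<longleftrightarrow> w = 0 \<or> b = 0"

text \<open>
  The randomness of a draw is carried by a number \<open>u\<close>, uniform on \<open>[0,1]\<close>: with the balls
  numbered \<open>0, \<dots>, w + b - 1\<close>, white ones first, ball number \<open>\<lfloor>u * (w + b)\<rfloor>\<close> is drawn, so that
  the drawn ball is white iff \<open>u < w / (w + b)\<close>. Monochromatic states are frozen.
\<close>

fun draw :: "real \<Rightarrow> nat \<times> nat \<Rightarrow> nat \<times> nat" where
  "draw u (w, b) =
    (if monochromatic (w, b) then (w, b)
     else if u < real w / (real w + real b) then (w + 1, b - 1)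
     else (w - 1, b + 1))"

text \<open>
  The condition \<open>0 < b\<close> only concerns the stopped states without black balls, where there is
  no number of white balls that is one less than the number of black balls.
\<close>

fun policy_A :: "nat \<times> nat \<Rightarrow> nat \<times> nat" where
  "policy_A (w, b) = (if 0 < b \<and> b \<le> w then (b - 1, b) else (w, b))"

text \<open>The state after \<open>n\<close> draws, Policy A having been applied after the last one.\<close>

primrec A_process :: "nat \<times> nat \<Rightarrow> real stream \<Rightarrow> nat \<Rightarrow> nat \<times> nat" where
  "A_process s \<omega> 0 = policy_A s"
| "A_process s \<omega> (Suc n) = policy_A (draw (\<omega> !! n) (A_process s \<omega> n))"

text \<open>The number of draws until absorption; the infimum is \<open>\<infinity>\<close> if no monochromatic state is ever reached.\<close>

definition absorption_time :: "nat \<times> nat \<Rightarrow> real stream \<Rightarrow> ennreal" where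
  "absorption_time s \<omega> = (INF n \<in> {n. monochromatic (A_process s \<omega> n)}. of_nat n)"

abbreviation uniform01 :: "real measure" where
  "uniform01 \<equiv> uniform_measure lborel {0..1}"

definition T_A :: "nat \<Rightarrow> nat \<Rightarrow> ennreal" where
  "T_A w b = (\<integral>\<^sup>+ \<omega>. absorption_time (w, b) \<omega> \<partial>stream_space uniform01)"

lemma measurable_absorption_time:
  "absorption_time s \<in> borel_measurable (stream_space uniform01)"
proof -
  have draw: "(\<lambda>u. draw u t) \<in> measurable borel (count_space UNIV)" for t
    by (cases t) (simp del: monochromatic.simps)
  have [measurable]: "(\<lambda>\<omega>. A_process s \<omega> n) \<in> measurable (stream_space uniform01) (count_space UNIV)" for n
  proof (induction n)
    case (Suc n)
    have "(\<lambda>\<omega>. draw (\<omega> !! n) (A_process s \<omega> n)) \<in> measurable (stream_space uniform01) (count_space UNIV)"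
    proof (rule measurable_compose_countable[OF _ Suc])
      fix t
      have "(\<lambda>\<omega>. \<omega> !! n) \<in> measurable (stream_space uniform01) uniform01"
        by measurable
      then have "(\<lambda>\<omega>. \<omega> !! n) \<in> borel_measurable (stream_space uniform01)"
        by (simp cong: measurable_cong_sets)
      then show "(\<lambda>\<omega>. draw (\<omega> !! n) t) \<in> measurable (stream_space uniform01) (count_space UNIV)"
        using measurable_compose draw by blast
    qed
    then show ?case
      by simp
  qed simp
  have "absorption_time s =
      (\<lambda>\<omega>. INF n. if monochromatic (A_process s \<omega> n) then of_nat n else \<infinity>)"
  proof (intro ext antisym)
    fix \<omega>
    show "absorption_time s \<omega> \<le> (INF n. if monochromatic (A_process s \<omega> n) then of_nat n else \<infinity>)"
      unfolding absorption_time_def by (intro INF_greatest) (auto intro: INF_lower)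
    show "(INF n. if monochromatic (A_process s \<omega> n) then of_nat n else \<infinity>) \<le> absorption_time s \<omega>"
      unfolding absorption_time_def
    proof (rule INF_greatest)
      fix n assume "n \<in> {n. monochromatic (A_process s \<omega> n)}"
      then show "(INF n. if monochromatic (A_process s \<omega> n) then of_nat n else \<infinity>) \<le> (of_nat n :: ennreal)"
        by (intro INF_lower2[of n]) auto
    qed
  qed
  also have "\<dots> \<in> borel_measurable (stream_space uniform01)"
    by measurable
  finally show ?thesis .
qed

text \<open>The transition probabilities of the uncontrolled urn.\<close>

lemma measure_uniform01_lessThan:
  assumes "0 \<le> p" "p \<le> 1"
  shows "measure uniform01 {u. u < p} = p" "measure uniform01 {u. \<not> u < p} = 1 - p"
proof -
  have "{0..1} \<inter> {u. u < p} = {0..<p}" "{0..1} \<inter> {u. \<not> u < p} = {p..1}"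
    using assms by auto
  moreover have "{u::real. u < p} \<in> sets lborel" "{u::real. \<not> u < p} \<in> sets lborel"
    by measurable
  ultimately show "measure uniform01 {u. u < p} = p" "measure uniform01 {u. \<not> u < p} = 1 - p"
    using assms divide_ennreal[of p 1] divide_ennreal[of "1 - p" 1]
    by (simp_all add: measure_def emeasure_uniform_measure)
qed

lemma draw_probabilities:
  assumes "0 < w" "0 < b"
  shows "measure uniform01 {u. draw u (w, b) = (w + 1, b - 1)} = real w / (real w + real b)"
    and "measure uniform01 {u. draw u (w, b) = (w - 1, b + 1)} = real b / (real w + real b)"
proof -
  let ?p = "real w / (real w + real b)"
  have p: "0 \<le> ?p" "?p \<le> 1" "1 - ?p = real b / (real w + real b)"
    using assms by (auto simp: field_simps)
  have "{u. draw u (w, b) = (w + 1, b - 1)} = {u. u < ?p}"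
    "{u. draw u (w, b) = (w - 1, b + 1)} = {u. \<not> u < ?p}"
    using assms by auto
  then show "measure uniform01 {u. draw u (w, b) = (w + 1, b - 1)} = ?p"
    and "measure uniform01 {u. draw u (w, b) = (w - 1, b + 1)} = real b / (real w + real b)"
    using measure_uniform01_lessThan[OF p(1,2)] p(3) by simp_all
qed

end

theory Submission
  imports Defs "HOL-Real_Asymp.Real_Asymp"
begin

text \<open>
  Write \<open>a n\<close> for the expected time from \<open>n\<close> white and \<open>n\<close> black balls, and
  \<open>q n = 4 ^ n / (2 * n choose n)\<close>, \<open>L n = (\<Sum>i = 1..n. 1 / (2 * i - 1))\<close>. With
  \<open>2 * n + 1\<close> balls the controlled urn behaves like the uncontrolled one until it is absorbed or
  enters the state equivalent to \<open>(n, n)\<close>, so the first-step equations can be solved on each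
  such layer. A sum of ratios of partial binomial sums to binomial coefficients occurs in the
  solution and telescopes to \<open>L n / 2\<close>, which gives
  \<open>(q n + 1) * a (n + 1) = (q n - 1) * a n + (2 * n + 1) * L n\<close>.
  The sequence \<open>(n - q n / 2 + pi / 8) * L n - q n / 4 + 3 * pi / 16 - 1 / 4\<close> satisfies this
  recurrence up to an error tending to \<open>0\<close>. The recurrence contracts by
  \<open>(q n - 1) / (q n + 1) \<le> n / (n + 1)\<close>, so \<open>a n\<close> differs from that sequence by \<open>o(1)\<close>.
  Wallis' product and the expansion of the harmonic numbers finish the proof.
\<close>

section \<open>First-step analysis and finiteness of the expected time\<close>

text \<open>The process is defined by appending draws at the end, while first-step analysis splits
  off the first one. The restarted process applies the policy at time 0, which supplies the policy
  step due after that first draw.\<close>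

lemma A_process_Suc_shift:
  "A_process s \<omega> (Suc n) = A_process (draw (shd \<omega>) (policy_A s)) (stl \<omega>) n"
  by (induction n) simp_all

lemma INF_of_nat_ennreal:
  assumes "m \<in> A"
  shows "(INF n \<in> A. c + of_nat n :: ennreal) = c + of_nat (Inf A)"
  using assms
  by (intro antisym INF_lower INF_greatest add_left_mono of_nat_mono cInf_lower Inf_nat_def1) auto

lemma absorption_time_step:
  "absorption_time s (u ## \<omega>) =
    (if monochromatic (policy_A s) then 0 else 1 + absorption_time (draw u (policy_A s)) \<omega>)"
proof (cases "monochromatic (policy_A s)")
  case True
  then have "absorption_time s (u ## \<omega>) \<le> of_nat 0"
    unfolding absorption_time_def by (intro INF_lower) simp
  then show ?thesis
    using True by simp
next
  case False
  let ?s = "draw u (policy_A s)"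
  let ?M = "{n. monochromatic (A_process ?s \<omega> n)}"
  have "{n. monochromatic (A_process s (u ## \<omega>) n)}
      = Suc ` {n. monochromatic (A_process ?s \<omega> n)}" (is "?L = ?R")
  proof (intro set_eqI)
    fix n
    show "n \<in> ?L \<longleftrightarrow> n \<in> ?R"
      using False A_process_Suc_shift[of s "u ## \<omega>"] by (cases n) (auto simp del: A_process.simps(2))
  qed
  then have "absorption_time s (u ## \<omega>) =
      (INF n \<in> {n. monochromatic (A_process ?s \<omega> n)}. 1 + of_nat n)"
    unfolding absorption_time_def by (simp add: image_image)
  also have "\<dots> = 1 + absorption_time ?s \<omega>"
    unfolding absorption_time_def
    \<comment> \<open>If \<open>?M\<close> is empty, both sides are infinite. This case is split off
      because the infimum of the empty set in \<open>nat\<close> is not infinite.\<close>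
    using INF_of_nat_ennreal[of _ ?M 0] INF_of_nat_ennreal[of _ ?M 1] by (cases "?M = {}") auto
  finally show ?thesis
    using False by simp
qed

interpretation uniform01: prob_space uniform01
  by (rule prob_space_uniform_measure) simp_all

interpretation draws: prob_space "stream_space uniform01"
  by (rule uniform01.prob_space_stream_space)

lemma nn_integral_draw:
  assumes "0 < w" "0 < b"
  shows "(\<integral>\<^sup>+ u. f (draw u (w, b)) \<partial>uniform01) =
    ennreal (real w / (real w + real b)) * f (w + 1, b - 1) +
    ennreal (real b / (real w + real b)) * f (w - 1, b + 1)"
proof -
  let ?p = "real w / (real w + real b)"
  have "real w + real b > 0"
    using assms by simp
  then have "?p + real b / (real w + real b) = 1"
    by (simp add: add_divide_distrib[symmetric])
  then have p: "0 \<le> ?p" "?p \<le> 1" "1 - ?p = real b / (real w + real b)"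
    using divide_nonneg_nonneg[of "real w" "real w + real b"] divide_nonneg_nonneg[of "real b" "real w + real b"]
    by linarith+
  have [measurable]: "{u. u < ?p} \<in> sets uniform01" "{u. \<not> u < ?p} \<in> sets uniform01"
    by simp_all
  have "(\<integral>\<^sup>+ u. f (draw u (w, b)) \<partial>uniform01) =
    (\<integral>\<^sup>+ u. f (w + 1, b - 1) * indicator {u. u < ?p} u
        + f (w - 1, b + 1) * indicator {u. \<not> u < ?p} u \<partial>uniform01)"
    using assms by (intro nn_integral_cong) (auto simp: indicator_def)
  also have "\<dots> = f (w + 1, b - 1) * emeasure uniform01 {u. u < ?p}
      + f (w - 1, b + 1) * emeasure uniform01 {u. \<not> u < ?p}"
    by (subst nn_integral_add) (auto simp: nn_integral_cmult_indicator)
  finally show ?thesis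
    using measure_uniform01_lessThan[OF p(1,2)] p(3)
    by (simp add: uniform01.emeasure_eq_measure mult.commute)
qed

text \<open>Kept general in \<open>f\<close> and \<open>g\<close> so that it serves both the
  absorption time and its truncations, where \<open>g\<close> is truncated at \<open>Suc n\<close>
  and \<open>f\<close> at \<open>n\<close>.\<close>

lemma nn_integral_first_draw:
  fixes f :: "nat \<times> nat \<Rightarrow> real stream \<Rightarrow> ennreal"
  assumes meas: "\<And>s. f s \<in> borel_measurable (stream_space uniform01)"
    and meas': "g \<in> borel_measurable (stream_space uniform01)"
    and wb: "0 < w" "0 < b"
    and step: "\<And>u \<omega>. g (u ## \<omega>) = 1 + f (draw u (w, b)) \<omega>"
  shows "(\<integral>\<^sup>+ \<omega>. g \<omega> \<partial>stream_space uniform01) = 1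
    + ennreal (real w / (real w + real b)) * (\<integral>\<^sup>+ \<omega>. f (w + 1, b - 1) \<omega> \<partial>stream_space uniform01)
    + ennreal (real b / (real w + real b)) * (\<integral>\<^sup>+ \<omega>. f (w - 1, b + 1) \<omega> \<partial>stream_space uniform01)"
proof -
  let ?F = "\<lambda>s. 1 + (\<integral>\<^sup>+ \<omega>. f s \<omega> \<partial>stream_space uniform01)"
  let ?p = "real w / (real w + real b)" and ?q = "real b / (real w + real b)"
  have "real w + real b > 0"
    using wb by simp
  then have "?p + ?q = 1"
    by (simp add: add_divide_distrib[symmetric])
  then have pq: "ennreal ?p + ennreal ?q = 1"
    by (subst ennreal_plus[symmetric]) simp_all
  have "(\<integral>\<^sup>+ \<omega>. g \<omega> \<partial>stream_space uniform01) =
      (\<integral>\<^sup>+ u. \<integral>\<^sup>+ \<omega>. g (u ## \<omega>) \<partial>stream_space uniform01 \<partial>uniform01)"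
    by (rule uniform01.nn_integral_stream_space[OF meas'])
  also have "\<dots> = (\<integral>\<^sup>+ u. ?F (draw u (w, b)) \<partial>uniform01)"
    using meas by (intro nn_integral_cong)
      (simp add: step nn_integral_add draws.emeasure_space_1 del: draw.simps)
  also have "\<dots> = ennreal ?p * ?F (w + 1, b - 1) + ennreal ?q * ?F (w - 1, b + 1)"
    by (rule nn_integral_draw[OF wb])
  also have "\<dots> = (ennreal ?p + ennreal ?q)
    + ennreal ?p * (\<integral>\<^sup>+ \<omega>. f (w + 1, b - 1) \<omega> \<partial>stream_space uniform01)
    + ennreal ?q * (\<integral>\<^sup>+ \<omega>. f (w - 1, b + 1) \<omega> \<partial>stream_space uniform01)"
    by (simp add: distrib_left ac_simps)
  finally show ?thesis
    unfolding pq .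
qed

text \<open>The policy acts already at time 0, so the process sees its start only through the
  policy. This links layers with different numbers of balls.\<close>

lemma T_A_policy:
  assumes "policy_A (w, b) = policy_A (w', b')"
  shows "T_A w b = T_A w' b'"
proof -
  have "A_process (w, b) \<omega> n = A_process (w', b') \<omega> n" for \<omega> n
    using assms by (induction n) (simp_all del: policy_A.simps draw.simps)
  then show ?thesis
    unfolding T_A_def absorption_time_def by simp
qed

lemma T_A_0: "T_A 0 b = 0"
proof -
  have "absorption_time (0, b) = (\<lambda>\<omega>. 0)"
    using absorption_time_step[of "(0, b)" "shd \<omega>" "stl \<omega>" for \<omega>] by auto
  then show ?thesis
    unfolding T_A_def by simp
qed

lemma T_A_step:
  assumes "0 < w" "w < b"
  shows "T_A w b = 1 + ennreal (real w / (real w + real b)) * T_A (w + 1) (b - 1)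
    + ennreal (real b / (real w + real b)) * T_A (w - 1) (b + 1)"
  unfolding T_A_def
  by (rule nn_integral_first_draw[where f = absorption_time])
    (use assms measurable_absorption_time in \<open>auto simp: absorption_time_step\<close>)

text \<open>The bound works because \<open>w * (w + b)\<close> is a supersolution of the first-step equations for \<open>w < b\<close>.\<close>

lemma truncated_absorption_time_le:
  assumes "policy_A s = (w, b)"
  shows "(\<integral>\<^sup>+ \<omega>. min (absorption_time s \<omega>) (of_nat n) \<partial>stream_space uniform01)
    \<le> ennreal (real w * (real w + real b))"
  using assms
proof (induction n arbitrary: s w b)
  case 0
  then show ?case by simp
next
  case (Suc n)
  note [measurable] = measurable_absorption_time
  let ?t = "\<lambda>s. \<integral>\<^sup>+ \<omega>. min (absorption_time s \<omega>) (of_nat n) \<partial>stream_space uniform01"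
  show ?case
  proof (cases "monochromatic (w, b)")
    case True
    then have "absorption_time s \<omega> = 0" for \<omega>
      using absorption_time_step[of s "shd \<omega>" "stl \<omega>"] Suc.prems by simp
    then show ?thesis by simp
  next
    case False
    then have wb: "0 < w" "w < b"
      using Suc.prems by (cases s, auto split: if_splits)+
    let ?p = "real w / (real w + real b)" and ?q = "real b / (real w + real b)"
    have min_step: "min (1 + a) (1 + c) = 1 + min a c" for a c :: ennreal
      by (simp add: min_def ennreal_add_left_cancel_le)
    have "(\<integral>\<^sup>+ \<omega>. min (absorption_time s \<omega>) (of_nat (Suc n)) \<partial>stream_space uniform01)
        = 1 + ennreal ?p * ?t (w + 1, b - 1) + ennreal ?q * ?t (w - 1, b + 1)"
      by (rule nn_integral_first_draw[where f = "\<lambda>s \<omega>. min (absorption_time s \<omega>) (of_nat n)"])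
        (use wb False Suc.prems in \<open>auto simp: absorption_time_step min_step simp del: draw.simps\<close>)
    also have "?t (w - 1, b + 1) \<le> ennreal (real (w - 1) * (real w + real b))"
      using Suc.IH[of "(w - 1, b + 1)" "w - 1" "b + 1"] wb by (simp add: of_nat_diff)
    also have "?t (w + 1, b - 1) \<le> ennreal (real (w + 1) * (real w + real b))"
    proof (cases "w + 1 < b - 1")
      case True
      then show ?thesis
        using Suc.IH[of "(w + 1, b - 1)" "w + 1" "b - 1"] by (simp add: of_nat_diff)
    next
      case False
      \<comment> \<open>The policy fires here. It leaves at most \<open>w\<close> white balls and a
        smaller total, so the bound for the reduced state is below the one claimed.\<close>
      then have "policy_A (w + 1, b - 1) = (b - 2, b - 1)"
        using wb by (simp add: numeral_2_eq_2)
      then have "?t (w + 1, b - 1) \<le> ennreal (real (b - 2) * (real (b - 2) + real (b - 1)))"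
        by (rule Suc.IH)
      also have "\<dots> \<le> ennreal (real (w + 1) * (real w + real b))"
        using False wb by (intro ennreal_leI mult_mono) auto
      finally show ?thesis .
    qed
    also have "1 + ennreal ?p * ennreal (real (w + 1) * (real w + real b))
        + ennreal ?q * ennreal (real (w - 1) * (real w + real b))
        = ennreal (1 + real w * (real w + 1) + real b * (real w - 1))"
      using wb by (simp add: ennreal_mult[symmetric] ennreal_plus[symmetric] of_nat_diff ennreal_1[symmetric]
          del: ennreal_plus ennreal_1)
    \<comment> \<open>The left side exceeds the right by \<open>1 + w - b\<close>, which is
      nonpositive because \<open>w < b\<close>.\<close>
    also have "\<dots> \<le> ennreal (real w * (real w + real b))"
      using wb by (intro ennreal_leI) (simp add: algebra_simps)
    finally show ?thesis
      by (simp add: add_mono mult_left_mono)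
  qed
qed

text \<open>The bound on the truncated times is uniform in the truncation level, so it survives
  monotone convergence. Finiteness must be known before passing to \<open>enn2real\<close>, which
  sends infinity to 0.\<close>

lemma T_A_finite: "T_A w b < \<infinity>"
proof -
  obtain w' b' where *: "policy_A (w, b) = (w', b')" by fastforce
  note [measurable] = measurable_absorption_time
  have "(SUP n. min x (of_nat n)) = x" for x :: ennreal
  proof -
    have "(SUP n. min x (of_nat n)) = min x (SUP n. of_nat n)"
      by (simp add: inf_min[symmetric] inf_SUP)
    then show ?thesis
      by (simp add: ennreal_SUP_of_nat_eq_top)
  qed
  then have "T_A w b = (\<integral>\<^sup>+ \<omega>. (SUP n. min (absorption_time (w, b) \<omega>) (of_nat n)) \<partial>stream_space uniform01)"
    unfolding T_A_def by simp
  also have "\<dots> = (SUP n. \<integral>\<^sup>+ \<omega>. min (absorption_time (w, b) \<omega>) (of_nat n) \<partial>stream_space uniform01)"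
    by (rule nn_integral_monotone_convergence_SUP)
      (auto intro!: monoI le_funI min.mono simp: incseq_def)
  also have "\<dots> \<le> ennreal (real w' * (real w' + real b'))"
    using truncated_absorption_time_le[OF *] by (intro SUP_least)
  finally show ?thesis
    by (simp add: le_less_trans)
qed

lemma enn2real_T_A_step:
  assumes "0 < w" "w < b"
  shows "enn2real (T_A w b) = 1 + (real w * enn2real (T_A (w + 1) (b - 1))
    + real b * enn2real (T_A (w - 1) (b + 1))) / (real w + real b)"
proof -
  obtain x y where "T_A (w + 1) (b - 1) = ennreal x" "0 \<le> x" "T_A (w - 1) (b + 1) = ennreal y" "0 \<le> y"
    using T_A_finite by (metis ennreal_cases less_irrefl infinity_ennreal_def)
  then show ?thesis
    by (simp add: T_A_step[OF assms] ennreal_mult[symmetric] ennreal_1[symmetric]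
        ennreal_plus[symmetric] add_divide_distrib del: ennreal_plus ennreal_1)
qed

section \<open>Partial binomial sums and the solution of the first-step equations on a layer\<close>

definition odd_harm :: "nat \<Rightarrow> real" where
  "odd_harm n = (\<Sum>i = 1..n. 1 / (2 * real i - 1))"

text \<open>The reciprocal of the probability that \<open>2 * n\<close> fair coin tosses are
  balanced; it grows like \<open>sqrt (pi * n)\<close>.\<close>

definition inv_central :: "nat \<Rightarrow> real" where
  "inv_central n = 4 ^ n / real (2 * n choose n)"

text \<open>For the uncontrolled urn with \<open>M + 1\<close> balls, a harmonic function
  \<open>x\<close> with \<open>x 0 = 0\<close> has increments \<open>x (j + 1) - x j\<close>
  proportional to \<open>M choose j\<close>. The ratio is thus \<open>x j\<close> divided by its
  next increment.\<close>

definition tail_ratio :: "nat \<Rightarrow> nat \<Rightarrow> real" where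
  "tail_ratio M j = (\<Sum>v < j. real (M choose v)) / real (M choose j)"

lemma binomial_Suc_right_real:
  assumes "j \<le> M"
  shows "real (M choose Suc j) = (real M - real j) * real (M choose j) / (real j + 1)"
proof -
  have "Suc j * (M choose Suc j) = (M - j) * (M choose j)"
    by (simp only: binomial_absorption binomial_absorb_comp)
  from arg_cong[OF this, of real] have "(1 + real j) * real (M choose Suc j) = (real M - real j) * real (M choose j)"
    using assms by (simp only: of_nat_mult of_nat_Suc of_nat_diff)
  then show ?thesis
    by (simp add: eq_divide_eq add.commute mult.commute del: binomial_Suc_Suc)
qed

lemma binomial_Suc_Suc_real:
  "real (Suc M choose Suc j) = (real M + 1) * real (M choose j) / (real j + 1)"
proof -
  have "(1 + real j) * real (Suc M choose Suc j) = (1 + real M) * real (M choose j)"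
    using arg_cong[OF Suc_times_binomial[of j M], of real] by (simp only: of_nat_mult of_nat_Suc)
  then show ?thesis
    by (simp add: eq_divide_eq add.commute mult.commute del: binomial_Suc_Suc)
qed

lemma tail_ratio_Suc:
  assumes "j < M"
  shows "tail_ratio M (Suc j) = (real j + 1) * (tail_ratio M j + 1) / (real M - real j)"
proof -
  have "real (M choose j) > 0" "real M - real j > 0"
    using assms by simp_all
  then show ?thesis
    using assms by (simp add: tail_ratio_def binomial_Suc_right_real) (simp add: divide_simps)
qed

text \<open>By Pascal's rule, a partial sum of the next row is twice the old partial sum minus its
  last term.\<close>

lemma tail_ratio_Suc_row:
  assumes "1 \<le> j" "j \<le> M"
  shows "tail_ratio (Suc M) j / real j = (2 * (real M + 1 - real j) * (tail_ratio M j / real j) - 1) / (real M + 1)"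
proof -
  obtain i where j: "j = Suc i"
    using \<open>1 \<le> j\<close> by (cases j) auto
  have sum: "(\<Sum>v<Suc i. real (Suc M choose v)) = 2 * (\<Sum>v<Suc i. real (M choose v)) - real (M choose i)" for i
    by (induction i) simp_all
  have pos: "real (M choose i) > 0" "real M - real i > 0"
    using assms j by simp_all
  have right: "real (M choose Suc i) = (real M - real i) * real (M choose i) / (real i + 1)"
    using assms j by (intro binomial_Suc_right_real) simp
  show ?thesis
    unfolding j tail_ratio_def sum right binomial_Suc_Suc_real
    using pos by (simp add: divide_simps del: sum.lessThan_Suc) (simp add: algebra_simps del: sum.lessThan_Suc)
qed

text \<open>By symmetry the entries on either side of the middle have equal sums, so twice the
  partial sum plus the central coefficient is \<open>4 ^ n\<close>.\<close>

lemma tail_ratio_central: "tail_ratio (2 * n) n = (inv_central n - 1) / 2"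
proof -
  have "(\<Sum>v \<in> {n<..2 * n}. 2 * n choose v) = (\<Sum>v < n. 2 * n choose v)"
    by (rule sum.reindex_bij_witness[of _ "\<lambda>v. 2 * n - v" "\<lambda>v. 2 * n - v"])
      (auto simp: binomial_symmetric[symmetric])
  moreover have "{..2 * n} = {..<n} \<union> {n} \<union> {n<..2 * n}" by auto
  then have "(\<Sum>v \<le> 2 * n. 2 * n choose v) =
      (\<Sum>v < n. 2 * n choose v) + (2 * n choose n) + (\<Sum>v \<in> {n<..2 * n}. 2 * n choose v)"
    by (simp add: sum.union_disjoint disjoint_iff)
  ultimately have "2 * (\<Sum>v < n. 2 * n choose v) + (2 * n choose n) = 4 ^ n"
    using choose_row_sum[of "2 * n"] by (simp add: power_mult)
  then have "2 * (\<Sum>v < n. real (2 * n choose v)) + real (2 * n choose n) = 4 ^ n"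
    by (metis of_nat_add of_nat_mult of_nat_numeral of_nat_power of_nat_sum)
  then show ?thesis
    unfolding tail_ratio_def inv_central_def by (simp add: field_simps)
qed

text \<open>Creative telescoping in \<open>n\<close>: the change of the summand from row
  \<open>2 * n\<close> to row \<open>2 * n + 2\<close> is a difference in \<open>j\<close>. The
  boundary terms and the new summand \<open>j = n + 1\<close> together contribute
  \<open>1 / (2 * (2 * n + 1))\<close>.\<close>

lemma sum_tail_ratio: "(\<Sum>j = 1..n. tail_ratio (2 * n) j / real j) = odd_harm n / 2"
proof (induction n)
  case 0
  then show ?case by (simp add: odd_harm_def)
next
  case (Suc n)
  define K where "K = 2 * real n + 1"
  define D where "D = K * (K + 1)"
  \<comment> \<open>telescoping certificate, found by an ansatz with polynomial coefficients\<close>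
  define G where "G j = ((2 * real j - 3 * (K + 1)) * ((K - real j) * (tail_ratio (2 * n) j / real j)) - real j) / D"
    for j
  have pos: "K > 0" "D > 0" unfolding D_def K_def by simp_all
  have row: "tail_ratio (2 * Suc n) j / real j =
     (2 * (K + 1 - real j) * (2 * (K - real j) * (tail_ratio (2 * n) j / real j) - 1) - K) / D"
    if "1 \<le> j" "j \<le> 2 * n" for j
  proof -
    have "tail_ratio (Suc (2 * n)) j / real j = (2 * (K - real j) * (tail_ratio (2 * n) j / real j) - 1) / K"
      using tail_ratio_Suc_row[OF that] by (simp add: K_def)
    moreover have "tail_ratio (Suc (Suc (2 * n))) j / real j =
        (2 * (K + 1 - real j) * (tail_ratio (Suc (2 * n)) j / real j) - 1) / (K + 1)"
      using tail_ratio_Suc_row[of j "Suc (2 * n)"] that by (simp add: K_def)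
    moreover have "(2 * c * (x / K) - 1) / (K + 1) = (2 * c * x - K) / D" for c x :: real
      using pos by (simp add: D_def field_simps)
    ultimately show ?thesis
      by (simp only: mult_Suc_right add_2_eq_Suc)
  qed
  show ?case
  proof (cases "n = 0")
    \<comment> \<open>Computed directly, since the general argument evaluates row
      \<open>2 * n\<close> at index \<open>Suc n\<close>, which lies in that row only for positive
      \<open>n\<close>.\<close>
    case True
    then show ?thesis
      by (simp add: odd_harm_def tail_ratio_def numeral_2_eq_2)
  next
    case False
    have diff: "tail_ratio (2 * Suc n) j / real j - tail_ratio (2 * n) j / real j = G (Suc j) - G j"
      if "1 \<le> j" "j \<le> n" for j
    proof -
      define u where "u = tail_ratio (2 * n) j / real j"
      have r: "tail_ratio (2 * n) j = real j * u"
        using that unfolding u_def by simp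
      have j: "K - real (Suc j) > 0" "j < 2 * n"
        using that False by (simp_all add: K_def)
      \<comment> \<open>The factor \<open>K - real j\<close> in \<open>G\<close> becomes, at
        \<open>Suc j\<close>, the denominator of \<open>tail_ratio_Suc\<close>. Its cancellation
        leaves \<open>u\<close> as the only ratio, and the telescoping becomes a polynomial
        identity.\<close>
      have "tail_ratio (2 * n) (Suc j) / real (Suc j) = (real j * u + 1) / (K - real (Suc j))"
        using j by (simp add: tail_ratio_Suc r K_def add.commute)
      then have "(K - real (Suc j)) * (tail_ratio (2 * n) (Suc j) / real (Suc j)) = real j * u + 1"
        using j by (simp del: of_nat_Suc)
      then have G_Suc: "G (Suc j) = ((2 * real (Suc j) - 3 * (K + 1)) * (real j * u + 1) - real (Suc j)) / D"
        unfolding G_def by (simp only:)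
      have "tail_ratio (2 * Suc n) j / real j - u =
          (2 * (K + 1 - real j) * (2 * (K - real j) * u - 1) - K - D * u) / D"
        unfolding u_def using that row[of j] pos by (simp add: diff_divide_distrib)
      also have "2 * (K + 1 - real j) * (2 * (K - real j) * u - 1) - K - D * u =
          ((2 * real (Suc j) - 3 * (K + 1)) * (real j * u + 1) - real (Suc j))
          - ((2 * real j - 3 * (K + 1)) * ((K - real j) * u) - real j)"
        unfolding D_def of_nat_Suc by algebra
      finally show ?thesis
        unfolding G_Suc by (simp only: G_def u_def diff_divide_distrib)
    qed
    have "(\<Sum>j = 1..n. tail_ratio (2 * Suc n) j / real j) - (\<Sum>j = 1..n. tail_ratio (2 * n) j / real j)
        = (\<Sum>j = 1..n. G (Suc j) - G j)"
      unfolding sum_subtractf[symmetric] by (intro sum.cong refl diff) simp_all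
    also have "\<dots> = G (Suc n) - G 1"
      using sum_Suc_diff[of 1 n G] by simp
    finally have "(\<Sum>j = 1..Suc n. tail_ratio (2 * Suc n) j / real j) =
       odd_harm n / 2 + (G (Suc n) - G 1 + tail_ratio (2 * Suc n) (Suc n) / real (Suc n))"
      using Suc.IH by simp
    also have "G (Suc n) - G 1 + tail_ratio (2 * Suc n) (Suc n) / real (Suc n) = 1 / (2 * K)"
    proof -
      define m where "m = real (Suc n)"
      define u where "u = tail_ratio (2 * n) (Suc n) / m"
      have K: "K = 2 * m - 1"
        by (simp add: K_def m_def)
      have "(K - 1) * (tail_ratio (2 * n) 1 / real 1) = 1"
        using False by (simp add: tail_ratio_def K_def)
      then have "G 1 = ((2 - 3 * (K + 1)) * 1 - 1) / D"
        unfolding G_def by (simp only: of_nat_1 mult_1_right)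
      moreover have "G (Suc n) = ((2 * m - 3 * (K + 1)) * ((K - m) * u) - m) / D"
        unfolding G_def u_def m_def ..
      moreover have "tail_ratio (2 * Suc n) (Suc n) / real (Suc n) =
          (2 * (K + 1 - m) * (2 * (K - m) * u - 1) - K) / D"
        unfolding u_def m_def using False by (intro row) auto
      \<comment> \<open>At the boundary \<open>K = 2 * m - 1\<close>, so the coefficients of
        \<open>u\<close> cancel and no partial binomial sum remains.\<close>
      moreover have "((2 * m - 3 * (K + 1)) * ((K - m) * u) - m) - ((2 - 3 * (K + 1)) * 1 - 1)
          + (2 * (K + 1 - m) * (2 * (K - m) * u - 1) - K) = m"
        unfolding K by (simp add: algebra_simps)
      ultimately have "G (Suc n) - G 1 + tail_ratio (2 * Suc n) (Suc n) / real (Suc n) = m / D"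
        by (simp only: diff_divide_distrib[symmetric] add_divide_distrib[symmetric])
      also have "\<dots> = 1 / (2 * K)"
        using pos(1) unfolding D_def K by simp
      finally show ?thesis .
    qed
    also have "odd_harm n / 2 + 1 / (2 * K) = odd_harm (Suc n) / 2"
      unfolding odd_harm_def K_def by (simp add: add_divide_distrib add.commute mult.commute)
    finally show ?thesis .
  qed
qed

text \<open>Eliminating the state left of \<open>j\<close> from the first-step equations leaves one linear relation
  between \<open>x j\<close> and \<open>x (j + 1)\<close>.\<close>

lemma first_step_elimination:
  fixes x :: "nat \<Rightarrow> real"
  assumes x0: "x 0 = 0"
    and step: "\<And>w. 0 < w \<Longrightarrow> w \<le> n \<Longrightarrow> (real M + 1) * x w =
      real M + 1 + real w * x (Suc w) + (real M + 1 - real w) * x (w - 1)"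
    and "j \<le> n" "n < M"
  shows "x j = tail_ratio M j * (x (Suc j) - x j) + (real M + 1) * (\<Sum>i = 1..j. tail_ratio M i / real i)"
  using \<open>j \<le> n\<close>
proof (induction j)
  case 0
  then show ?case by (simp add: x0 tail_ratio_def)
next
  case (Suc j)
  define N where "N = real M + 1"
  define s where "s = tail_ratio M j"
  define d where "d = real M - real j"
  define i where "i = real j + 1"
  have d: "d > 0" and i: "i > 0" and N: "N = i + d"
    using Suc.prems \<open>n < M\<close> by (simp_all add: d_def i_def N_def)
  have "N * x (Suc j) = N + i * x (Suc (Suc j)) + d * x j"
    using step[of "Suc j"] Suc.prems by (simp add: N_def i_def d_def add.commute)
  \<comment> \<open>The first-step equation gives the left increment in terms of the right one,
    which carries the induction from \<open>j\<close> to \<open>Suc j\<close>.\<close>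
  then have "x (Suc j) - x j = (i * (x (Suc (Suc j)) - x (Suc j)) + N) / d"
    using d unfolding N by (simp add: field_simps)
  moreover have "x (Suc j) = (s + 1) * (x (Suc j) - x j) + N * (\<Sum>i = 1..j. tail_ratio M i / real i)"
    using Suc by (simp add: s_def N_def algebra_simps)
  moreover have "tail_ratio M (Suc j) = i * (s + 1) / d"
    using tail_ratio_Suc[of j M] d by (simp add: i_def d_def s_def)
  moreover have "real (Suc j) = i"
    by (simp add: i_def)
  moreover have "(s + 1) * ((i * y + N) / d) + N * c = i * (s + 1) / d * y + N * (c + i * (s + 1) / d / i)"
    for y c
    using i d by (simp add: field_simps)
  ultimately show ?case
    unfolding N_def[symmetric] by simp
qed

lemma T_A_recurrence:
  assumes "0 < n"
  shows "(inv_central n + 1) * enn2real (T_A (Suc n) (Suc n)) =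
    (inv_central n - 1) * enn2real (T_A n n) + (2 * real n + 1) * odd_harm n"
proof -
  define x where "x w = enn2real (T_A w (2 * n + 1 - w))" for w
  have "(real (2 * n) + 1) * x w =
      real (2 * n) + 1 + real w * x (Suc w) + (real (2 * n) + 1 - real w) * x (w - 1)"
    if "0 < w" "w \<le> n" for w
  proof -
    have "x w = 1 + (real w * x (Suc w) + real (2 * n + 1 - w) * x (w - 1)) / (real w + real (2 * n + 1 - w))"
      using enn2real_T_A_step[of w "2 * n + 1 - w"] that by (simp add: x_def Suc_diff_le)
    moreover have "real (2 * n + 1 - w) = real (2 * n) + 1 - real w"
      using that by (simp add: of_nat_diff)
    ultimately show ?thesis
      by (simp add: field_simps)
  qed
  then have "x n = tail_ratio (2 * n) n * (x (Suc n) - x n)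
      + (real (2 * n) + 1) * (\<Sum>i = 1..n. tail_ratio (2 * n) i / real i)"
    using assms by (intro first_step_elimination[of x n "2 * n" n]) (simp_all add: x_def T_A_0)
  \<comment> \<open>The state \<open>(n + 1, n + 1)\<close> is reduced to \<open>(n, n + 1)\<close>,
    which lies in this layer. At the other end \<open>(n + 1, n)\<close> and \<open>(n, n)\<close>
    are both reduced to \<open>(n - 1, n)\<close>.\<close>
  moreover have "x n = enn2real (T_A (Suc n) (Suc n))" "x (Suc n) = enn2real (T_A n n)"
    unfolding x_def using assms
    by (auto intro!: arg_cong[where f = enn2real] T_A_policy simp: Suc_diff_le)
  ultimately show ?thesis
    unfolding tail_ratio_central sum_tail_ratio by (simp add: field_simps)
qed

section \<open>Bounds for \<open>inv_central\<close> from Wallis' product\<close>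

lemma inv_central_Suc: "inv_central (Suc n) = inv_central n * (2 * real n + 2) / (2 * real n + 1)"
proof -
  have "real (Suc (2 * n) choose n) = real (Suc (2 * n) choose Suc n)"
    using binomial_symmetric[of n "Suc (2 * n)"] by (simp add: Suc_diff_le)
  then have "real (2 * Suc n choose Suc n) =
      (2 * real n + 2) * ((2 * real n + 1) * real (2 * n choose n) / (real n + 1)) / (real n + 1)"
    using binomial_Suc_Suc_real[of "Suc (2 * n)" n] binomial_Suc_Suc_real[of "2 * n" n]
    by (simp add: add_ac del: binomial_Suc_Suc)
  also have "\<dots> = 4 * real (2 * n choose n) * (2 * real n + 1) / (2 * real n + 2)"
    by (simp add: divide_simps) (simp add: algebra_simps)
  finally show ?thesis
    unfolding inv_central_def by simp
qed

lemma inv_central_pos: "inv_central n > 0"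
  by (simp add: inv_central_def)

lemma inv_central_ge_1: "inv_central n \<ge> 1"
proof (induction n)
  case (Suc n)
  have "1 * 1 \<le> inv_central n * ((2 * real n + 2) / (2 * real n + 1))"
    using inv_central_pos[of n] by (intro mult_mono Suc) auto
  then show ?case
    by (simp add: inv_central_Suc)
qed (simp add: inv_central_def)

text \<open>Crude compared with the true square-root growth, but equivalent to the contraction bound
  \<open>(q - 1) / (q + 1) <= n / (n + 1)\<close> for \<open>q = inv_central n\<close>.\<close>

lemma inv_central_le: "inv_central n \<le> 2 * real n + 1"
proof (induction n)
  case (Suc n)
  have "inv_central n * (2 * real n + 2) \<le> (2 * real n + 1) * (2 * real n + 2)"
    by (intro mult_right_mono Suc) simp
  then have "inv_central (Suc n) \<le> 2 * real n + 2"
    by (simp add: inv_central_Suc divide_le_eq mult.commute)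
  then show ?case by simp
qed (simp add: inv_central_def)

text \<open>The quotient is exactly the \<open>n\<close>-th partial Wallis product, as
  \<open>inv_central_Suc\<close> shows factor by factor.\<close>

lemma wallis_inv_central: "(\<lambda>n. (inv_central n)\<^sup>2 / (2 * real n + 1)) \<longlonglongrightarrow> pi / 2"
proof -
  have "(inv_central n)\<^sup>2 / (2 * real n + 1) = (\<Prod>k = 1..n. (4 * real k ^ 2) / (4 * real k ^ 2 - 1))" for n
  proof (induction n)
    case (Suc n)
    define a where "a = 2 * real n + 1"
    have a: "a > 0" "2 * real n + 2 = a + 1" "2 * real n + 1 = a" "2 * real (Suc n) + 1 = a + 2"
      "4 * (real (Suc n))\<^sup>2 = (a + 1)\<^sup>2"
      by (simp_all add: a_def power2_eq_square algebra_simps)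
    have "(inv_central n * (a + 1) / a)\<^sup>2 / (a + 2) = (inv_central n)\<^sup>2 / a * ((a + 1)\<^sup>2 / ((a + 1)\<^sup>2 - 1))"
    proof -
      have "(a + 1)\<^sup>2 - 1 = a * (a + 2)"
        by algebra
      then show ?thesis
        using a(1) by (simp add: power_divide power_mult_distrib) (simp add: power2_eq_square)
    qed
    then show ?case
      using Suc.IH by (simp only: prod.cl_ivl_Suc inv_central_Suc a) simp
  qed (simp add: inv_central_def)
  then show ?thesis
    using wallis by simp
qed

text \<open>The Wallis quotients increase, so each lies below the limit
  \<open>pi / 2\<close>.\<close>

lemma inv_central_square_le: "(inv_central n)\<^sup>2 \<le> pi * (real n + 1 / 2)"
proof -
  have "(inv_central n)\<^sup>2 / (2 * real n + 1) \<le> (inv_central (Suc n))\<^sup>2 / (2 * real (Suc n) + 1)" for n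
  proof -
    define a where "a = 2 * real n + 1"
    have a: "a > 0" "2 * real n + 2 = a + 1" "2 * real n + 1 = a" "2 * real (Suc n) + 1 = a + 2"
      by (simp_all add: a_def)
    have "1 / a \<le> (a + 1)\<^sup>2 / (a\<^sup>2 * (a + 2))"
      using a(1) by (simp add: divide_simps) (simp add: power2_eq_square algebra_simps)
    then have "(inv_central n)\<^sup>2 * (1 / a) \<le> (inv_central n)\<^sup>2 * ((a + 1)\<^sup>2 / (a\<^sup>2 * (a + 2)))"
      by (intro mult_left_mono) simp_all
    then show ?thesis
      unfolding inv_central_Suc a by (simp add: power_divide power_mult_distrib)
  qed
  then have "incseq (\<lambda>n. (inv_central n)\<^sup>2 / (2 * real n + 1))"
    by (rule incseq_SucI)
  from incseq_le[OF this wallis_inv_central, of n] show ?thesis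
    by (simp add: divide_le_eq algebra_simps)
qed

text \<open>Dividing by \<open>2 * n\<close> instead of \<open>2 * n + 1\<close> gives a decreasing
  sequence with the same limit, so the square is known up to \<open>pi / 2\<close>.\<close>

lemma inv_central_square_ge: "pi * real n \<le> (inv_central n)\<^sup>2"
proof (cases "n = 0")
  case False
  let ?f = "\<lambda>n. (inv_central (Suc n))\<^sup>2 / (2 * real (Suc n))"
  have "?f (Suc m) \<le> ?f m" for m
  proof -
    define a where "a = 2 * real (Suc m) + 1"
    have a: "a > 1" "2 * real (Suc m) + 2 = a + 1" "2 * real (Suc m) + 1 = a" "2 * real (Suc (Suc m)) = a + 1"
      "2 * real (Suc m) = a - 1"
      by (simp_all add: a_def)
    have "(a + 1)\<^sup>2 / (a\<^sup>2 * (a + 1)) \<le> 1 / (a - 1)"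
      using a(1) by (simp add: divide_simps) (simp add: power2_eq_square algebra_simps)
    then have "(inv_central (Suc m))\<^sup>2 * ((a + 1)\<^sup>2 / (a\<^sup>2 * (a + 1))) \<le> (inv_central (Suc m))\<^sup>2 * (1 / (a - 1))"
      by (intro mult_left_mono) simp_all
    then show ?thesis
      unfolding inv_central_Suc[of "Suc m"] a by (simp add: power_divide power_mult_distrib add.commute)
  qed
  then have "decseq ?f"
    by (rule decseq_SucI)
  moreover have "?f \<longlonglongrightarrow> pi / 2"
  proof -
    have "(\<lambda>n. (2 * real (Suc n) + 1) / (2 * real (Suc n))) \<longlonglongrightarrow> 1"
      by real_asymp
    from tendsto_mult[OF LIMSEQ_Suc[OF wallis_inv_central] this]
    have "(\<lambda>n. (inv_central (Suc n))\<^sup>2 / (2 * real (Suc n) + 1) * ((2 * real (Suc n) + 1) / (2 * real (Suc n))))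
        \<longlonglongrightarrow> pi / 2"
      by simp
    moreover have "2 * real (Suc n) + 1 \<noteq> 0" for n
      by (simp add: add_nonneg_eq_0_iff)
    ultimately show ?thesis
      by (simp del: of_nat_Suc)
  qed
  ultimately have "pi / 2 \<le> ?f (n - 1)"
    by (rule decseq_ge)
  then show ?thesis
    using False by (simp add: le_divide_eq algebra_simps)
qed simp

section \<open>Asymptotics of the odd harmonic sums\<close>

lemma odd_harm_eq_harm: "odd_harm n = harm (2 * n) - harm n / 2"
proof (induction n)
  case (Suc n)
  have "1 / (2 * real (Suc n) - 1) = 1 / (2 * real n + 1)"
    by simp
  then have "odd_harm (Suc n) = odd_harm n + 1 / (2 * real n + 1)"
    by (simp add: odd_harm_def)
  moreover have "harm (2 * Suc n) = harm (2 * n) + 1 / (2 * real n + 1) + 1 / (real n + 1) / 2"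
    by (simp add: harm_Suc inverse_eq_divide add.commute)
  ultimately show ?case
    using Suc by (simp add: harm_Suc inverse_eq_divide add.commute add_divide_distrib)
qed (simp add: odd_harm_def harm_def)

text \<open>With gamma for \<open>euler_mascheroni\<close>, this is
  \<open>ln (2 * n) + gamma - (ln n + gamma) / 2\<close>, the leading part of
  \<open>harm (2 * n) - harm n / 2\<close>.\<close>

definition log_term :: "nat \<Rightarrow> real" where
  "log_term n = (ln (real n) + ln 4 + euler_mascheroni) / 2"

text \<open>The rate must beat \<open>1 / n\<close> because \<open>odd_harm n\<close> is later
  multiplied by \<open>n\<close>. It does so because the corrections \<open>1 / (4 * n)\<close> of
  \<open>harm (2 * n)\<close> and of \<open>harm n / 2\<close> cancel.\<close>

lemma odd_harm_asymp: "(\<lambda>n. real n * (odd_harm n - log_term n)) \<longlonglongrightarrow> 0"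
proof (rule tendsto_sandwich)
  define g :: real where "g = euler_mascheroni"
  \<comment> \<open>Both bounds insert \<open>euler_mascheroni_bounds\<close> at \<open>n\<close>
    and \<open>2 * n\<close>; the constant \<open>g\<close> cancels, leaving elementary
    functions.\<close>
  define lo where "lo n = real n * (ln (2 * real n + 1) - 1 / (4 * real n)
     - (ln (real n + 1) - 1 / (2 * (real n + 1))) / 2 - ln (real n) / 2 - ln 2)" for n
  define hi where "hi n = real n * (ln (2 * real n + 1) - 1 / (2 * (2 * real n + 1))
     - (ln (real n + 1) - 1 / (2 * real n)) / 2 - ln (real n) / 2 - ln 2)" for n
  have ln4: "ln 4 = 2 * ln (2::real)"
    using ln_realpow[of 2 2] by simp
  show "lo \<longlonglongrightarrow> 0"
    unfolding lo_def by real_asymp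
  show "hi \<longlonglongrightarrow> 0"
    unfolding hi_def by real_asymp
  have *: "g + (ln (real n + 1) - 1 / (2 * real n)) \<le> harm n"
      "harm n \<le> g + (ln (real n + 1) - 1 / (2 * (real n + 1)))" if "n \<ge> 1" for n
    using euler_mascheroni_bounds[OF that] by (simp_all add: g_def inverse_eq_divide algebra_simps)
  have **: "g + (ln (2 * real n + 1) - 1 / (4 * real n)) \<le> harm (2 * n)"
      "harm (2 * n) \<le> g + (ln (2 * real n + 1) - 1 / (2 * (2 * real n + 1)))" if "n \<ge> 1" for n
    using *[of "2 * n"] that by simp_all
  have lower: "x - y / 2 - l / 2 - t \<le> b - a / 2 - (l + 2 * t + g) / 2" if "g + x \<le> b" "a \<le> g + y" for x y l t a b
    using that by argo
  have upper: "b - a / 2 - (l + 2 * t + g) / 2 \<le> x - y / 2 - l / 2 - t" if "b \<le> g + x" "g + y \<le> a" for x y l t a b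
    using that by argo
  show "\<forall>\<^sub>F n in sequentially. lo n \<le> real n * (odd_harm n - log_term n)"
    using eventually_ge_at_top[of 1]
  proof eventually_elim
    case (elim n)
    show ?case
      unfolding lo_def odd_harm_eq_harm log_term_def g_def[symmetric] ln4
      by (intro mult_left_mono lower * ** elim of_nat_0_le_iff)
  qed
  show "\<forall>\<^sub>F n in sequentially. real n * (odd_harm n - log_term n) \<le> hi n"
    using eventually_ge_at_top[of 1]
  proof eventually_elim
    case (elim n)
    show ?case
      unfolding hi_def odd_harm_eq_harm log_term_def g_def[symmetric] ln4
      by (intro mult_left_mono upper * ** elim of_nat_0_le_iff)
  qed
qed

section \<open>Stability of the recurrence\<close>

text \<open>Once the error is below \<open>2 * e\<close>, the identity
  \<open>(q + 1) * e = (q - 1) * e + 2 * e\<close> shows that subtracting \<open>e\<close> from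
  \<open>\<bar>d n\<bar>\<close> absorbs it. The remaining factor is at most
  \<open>n / (n + 1)\<close>, so \<open>n * (\<bar>d n\<bar> - e)\<close> stays bounded
  above.\<close>

lemma tendsto_zero_of_contraction:
  fixes d q E :: "nat \<Rightarrow> real"
  assumes rec: "\<And>n. 0 < n \<Longrightarrow> (q n + 1) * d (Suc n) = (q n - 1) * d n + E n"
    and q: "\<And>n. 1 \<le> q n" "\<And>n. q n \<le> 2 * real n + 1"
    and E: "E \<longlonglongrightarrow> 0"
  shows "d \<longlonglongrightarrow> 0"
proof (rule LIMSEQ_I)
  fix \<epsilon> :: real assume "0 < \<epsilon>"
  define e where "e = \<epsilon> / 2"
  have "0 < e" using \<open>0 < \<epsilon>\<close> by (simp add: e_def)
  obtain N0 where N0: "\<And>n. n \<ge> N0 \<Longrightarrow> \<bar>E n\<bar> < 2 * e"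
    using LIMSEQ_D[OF E, of "2 * e"] \<open>0 < e\<close> by auto
  define N where "N = max 1 N0"
  define C where "C = real N * \<bar>d N\<bar>"
  have bound: "real n * (\<bar>d n\<bar> - e) \<le> C" if "n \<ge> N" for n
    using that
  proof (induction n rule: dec_induct)
    case base
    have "real N * (\<bar>d N\<bar> - e) \<le> real N * \<bar>d N\<bar>"
      using \<open>0 < e\<close> by (intro mult_left_mono) simp_all
    then show ?case
      by (simp add: C_def)
  next
    case (step n)
    define x where "x = \<bar>d n\<bar> - e"
    define y where "y = \<bar>d (Suc n)\<bar> - e"
    have n: "0 < n" "N0 \<le> n"
      using step.hyps by (simp_all add: N_def)
    have "(q n + 1) * \<bar>d (Suc n)\<bar> = \<bar>(q n - 1) * d n + E n\<bar>"
      using rec[OF n(1)] q(1)[of n] by (simp add: abs_mult flip: rec[OF n(1)])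
    also have "\<dots> \<le> (q n - 1) * \<bar>d n\<bar> + 2 * e"
      using N0[OF n(2)] q(1)[of n] abs_triangle_ineq[of "(q n - 1) * d n" "E n"] by (simp add: abs_mult)
    finally have le: "(q n + 1) * y \<le> (q n - 1) * x"
      by (simp add: x_def y_def algebra_simps)
    show ?case
    proof (cases "y \<le> 0")
      case True
      then have "real (Suc n) * y \<le> 0"
        by (intro mult_nonneg_nonpos) simp_all
      also have "0 \<le> C"
        by (simp add: C_def)
      finally show ?thesis
        by (simp add: y_def)
    next
      \<comment> \<open>Here \<open>x\<close> is nonnegative too, so the inequality between
        coefficients coming from \<open>q n \<le> 2 * n + 1\<close> may be multiplied by it.\<close>
      case False
      then have "0 < (q n - 1) * x"
        using le q(1)[of n] mult_pos_pos[of "q n + 1" y] by linarith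
      then have "0 \<le> x"
        using q(1)[of n] by (simp add: zero_less_mult_iff)
      have "(q n + 1) * (real (Suc n) * y) \<le> real (Suc n) * ((q n - 1) * x)"
        using mult_left_mono[OF le, of "real (Suc n)"] by (simp add: ac_simps)
      also have "\<dots> = (real (Suc n) * (q n - 1)) * x"
        by simp
      also have "\<dots> \<le> ((q n + 1) * real n) * x"
        using q(2)[of n] \<open>0 \<le> x\<close> by (intro mult_right_mono) (simp_all add: algebra_simps)
      finally have "real (Suc n) * y \<le> real n * x"
        using q(1)[of n] by (simp add: mult.assoc)
      then show ?thesis
        using step.IH by (simp add: x_def y_def)
    qed
  qed
  have "(\<lambda>n. C / real n) \<longlonglongrightarrow> 0"
    by (rule lim_const_over_n)
  from LIMSEQ_D[OF this \<open>0 < e\<close>] obtain N1 where N1: "\<And>n. n \<ge> N1 \<Longrightarrow> \<bar>C / real n\<bar> < e"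
    by auto
  have "\<bar>d n\<bar> < \<epsilon>" if "n \<ge> max N N1" for n
  proof -
    have "0 < real n"
      using that by (simp add: N_def)
    then have "\<bar>d n\<bar> - e \<le> C / real n"
      using bound[of n] that by (simp add: le_divide_eq mult.commute)
    moreover have "C / real n < e"
      by (rule order.strict_trans1[OF abs_ge_self N1]) (use that in simp)
    ultimately show ?thesis
      unfolding e_def by linarith
  qed
  then show "\<exists>no. \<forall>n\<ge>no. norm (d n - 0) < \<epsilon>"
    by (intro exI[of _ "max N N1"]) simp
qed

section \<open>Error terms of order \<open>1 / sqrt n\<close>\<close>

lemma odd_harm_minus_log_term: "(\<lambda>n. odd_harm n - log_term n) \<longlonglongrightarrow> 0"
proof (rule Lim_transform_eventually)
  show "(\<lambda>n. inverse (real n) * (real n * (odd_harm n - log_term n))) \<longlonglongrightarrow> 0"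
    using tendsto_mult[OF lim_inverse_n odd_harm_asymp] by simp
  show "\<forall>\<^sub>F n in sequentially. inverse (real n) * (real n * (odd_harm n - log_term n)) = odd_harm n - log_term n"
    using eventually_gt_at_top[of 0] by eventually_elim simp
qed

text \<open>A rate of \<open>1 / sqrt n\<close> beats logarithmic growth. For
  \<open>odd_harm\<close> the product is split into \<open>log_term n * f n\<close> and a product of
  two null sequences.\<close>

lemma inverse_sqrt_bounded_tendsto:
  fixes f :: "nat \<Rightarrow> real"
  assumes f: "\<And>n. 0 < n \<Longrightarrow> 0 \<le> f n" "\<And>n. 0 < n \<Longrightarrow> f n \<le> 1 / sqrt (real n)"
  shows "f \<longlonglongrightarrow> 0" and "(\<lambda>n. log_term n * f n) \<longlonglongrightarrow> 0" and "(\<lambda>n. odd_harm n * f n) \<longlonglongrightarrow> 0"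
proof -
  have ev: "\<forall>\<^sub>F n in sequentially. 0 < (n::nat)"
    by (rule eventually_gt_at_top)
  show f0: "f \<longlonglongrightarrow> 0"
  proof (rule tendsto_sandwich)
    show "\<forall>\<^sub>F n in sequentially. 0 \<le> f n"
      using ev by eventually_elim (rule f)
    show "\<forall>\<^sub>F n in sequentially. f n \<le> 1 / sqrt (real n)"
      using ev by eventually_elim (rule f)
    show "(\<lambda>n. 1 / sqrt (real n)) \<longlonglongrightarrow> 0"
      by real_asymp
  qed simp
  have nonneg: "0 \<le> log_term n" if "0 < n" for n
    using that euler_mascheroni_pos unfolding log_term_def by simp
  show log0: "(\<lambda>n. log_term n * f n) \<longlonglongrightarrow> 0"
  proof (rule tendsto_sandwich)
    show "\<forall>\<^sub>F n in sequentially. 0 \<le> log_term n * f n"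
      using ev by eventually_elim (simp add: f nonneg)
    show "\<forall>\<^sub>F n in sequentially. log_term n * f n \<le> log_term n * (1 / sqrt (real n))"
      using ev by eventually_elim (simp add: mult_left_mono f nonneg del: times_divide_eq_right)
    show "(\<lambda>n. log_term n * (1 / sqrt (real n))) \<longlonglongrightarrow> 0"
      unfolding log_term_def by real_asymp
  qed simp
  have "(\<lambda>n. (odd_harm n - log_term n) * f n + log_term n * f n) \<longlonglongrightarrow> 0 * 0 + 0"
    by (intro tendsto_intros f0 log0 odd_harm_minus_log_term)
  then show "(\<lambda>n. odd_harm n * f n) \<longlonglongrightarrow> 0"
    by (simp add: algebra_simps)
qed

text \<open>By \<open>inv_central_Suc\<close> this is the increment
  \<open>inv_central (Suc n) - inv_central n\<close>.\<close>

definition step_ratio :: "nat \<Rightarrow> real" where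
  "step_ratio n = inv_central n / (2 * real n + 1)"

lemma step_ratio_bounds:
  assumes "0 < n"
  shows "0 \<le> step_ratio n" "step_ratio n \<le> 1 / sqrt (real n)"
proof -
  show "0 \<le> step_ratio n"
    using inv_central_pos[of n] by (simp add: step_ratio_def)
  have "(step_ratio n)\<^sup>2 = (inv_central n)\<^sup>2 / (2 * real n + 1)\<^sup>2"
    by (simp add: step_ratio_def power_divide)
  also have "\<dots> \<le> (4 * (real n + 1 / 2)) / (2 * real n + 1)\<^sup>2"
    using inv_central_square_le[of n] mult_right_mono[of pi 4 "real n + 1 / 2"] pi_less_4
    by (intro divide_right_mono) simp_all
  also have "\<dots> = 2 / (2 * real n + 1)"
    by (simp add: divide_simps power2_eq_square)
  also have "\<dots> \<le> 1 / real n"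
    using assms by (simp add: field_simps)
  also have "\<dots> = (1 / sqrt (real n))\<^sup>2"
    by (simp add: power_divide)
  finally show "step_ratio n \<le> 1 / sqrt (real n)"
    by (rule power2_le_imp_le) simp
qed

text \<open>The two square bounds give a defect of order \<open>1 / n\<close>; it is weakened to fit
  \<open>inverse_sqrt_bounded_tendsto\<close>.\<close>

lemma wallis_defect_bounds:
  assumes "0 < n"
  shows "0 \<le> pi / 2 - inv_central n * step_ratio n"
    "pi / 2 - inv_central n * step_ratio n \<le> 2 / sqrt (real n)"
proof -
  have eq: "inv_central n * step_ratio n = (inv_central n)\<^sup>2 / (2 * real n + 1)"
    by (simp add: step_ratio_def power2_eq_square)
  show "0 \<le> pi / 2 - inv_central n * step_ratio n"
    unfolding eq using inv_central_square_le[of n] by (simp add: field_simps)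
  have "pi / 2 - inv_central n * step_ratio n \<le> pi / 2 - pi * real n / (2 * real n + 1)"
    unfolding eq using inv_central_square_ge[of n] by (intro diff_left_mono divide_right_mono) simp_all
  also have "\<dots> = pi / (2 * (2 * real n + 1))"
    by (simp add: field_simps)
  also have "\<dots> \<le> 4 / (2 * real n)"
    using assms pi_less_4 by (intro frac_le) simp_all
  also have "\<dots> = 2 / real n"
    by simp
  also have "\<dots> \<le> 2 / sqrt (real n)"
    using assms by (intro divide_left_mono) (simp_all add: real_sqrt_le_iff real_le_lsqrt power2_eq_square)
  finally show "pi / 2 - inv_central n * step_ratio n \<le> 2 / sqrt (real n)" .
qed

text \<open>The difference of the squares is at most \<open>pi / 2\<close>, while the sum of the two
  numbers is at least \<open>2 * sqrt n\<close>.\<close>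

lemma inv_central_minus_sqrt_bounds:
  assumes "0 < n"
  shows "0 \<le> inv_central n - sqrt (pi * real n)" "inv_central n - sqrt (pi * real n) \<le> 1 / sqrt (real n)"
proof -
  define s where "s = sqrt (pi * real n)"
  have "s \<le> sqrt ((inv_central n)\<^sup>2)"
    unfolding s_def by (rule real_sqrt_le_mono[OF inv_central_square_ge])
  then show ge: "0 \<le> inv_central n - sqrt (pi * real n)"
    using inv_central_pos[of n] by (simp add: s_def)
  have s: "s\<^sup>2 = pi * real n"
    by (simp add: s_def)
  have "sqrt (real n) \<le> s"
    unfolding s_def using pi_ge_two mult_right_mono[of 1 pi "real n"] by (intro real_sqrt_le_mono) simp
  then have "2 * sqrt (real n) \<le> inv_central n + s"
    using ge unfolding s_def by linarith
  then have "(inv_central n - s) * (2 * sqrt (real n)) \<le> (inv_central n - s) * (inv_central n + s)"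
    using ge by (intro mult_left_mono) (simp_all add: s_def)
  also have "\<dots> = (inv_central n)\<^sup>2 - s\<^sup>2"
    by (simp add: power2_eq_square algebra_simps)
  also have "\<dots> \<le> pi / 2"
    using inv_central_square_le[of n] unfolding s by (simp add: algebra_simps)
  also have "\<dots> \<le> 2"
    using pi_less_4 by simp
  finally have "(inv_central n - s) * sqrt (real n) \<le> 1"
    by simp
  then show "inv_central n - sqrt (pi * real n) \<le> 1 / sqrt (real n)"
    using assms by (simp add: s_def le_divide_eq)
qed

section \<open>The approximating sequence and its limit form\<close>

text \<open>Logarithm and square root are replaced by \<open>odd_harm\<close> and
  \<open>inv_central\<close>, whose increments are exact. As
  \<open>inv_central n * step_ratio n\<close> tends to \<open>pi / 2\<close>, the constant
  \<open>pi / 8\<close> makes the coefficient of \<open>odd_harm n\<close> in the residual vanish in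
  the limit, and \<open>3 * pi / 16 - 1 / 4\<close> removes the remaining constant.\<close>

definition T_A_approx :: "nat \<Rightarrow> real" where
  "T_A_approx n = (real n - inv_central n / 2 + pi / 8) * odd_harm n - inv_central n / 4 + (3 * pi / 16 - 1 / 4)"

lemma T_A_approx_residual:
  "(\<lambda>n. (inv_central n - 1) * T_A_approx n + (2 * real n + 1) * odd_harm n
      - (inv_central n + 1) * T_A_approx (Suc n)) \<longlonglongrightarrow> 0"
proof -
  define t where "t n = 1 / (2 * real n + 1)" for n :: nat
  define p where "p n = inv_central n * step_ratio n" for n
  define h where "h n = (pi / 2 - p n) / 2" for n
  \<comment> \<open>Regrouped so that \<open>odd_harm n\<close> meets only factors of order
    \<open>1 / sqrt n\<close>. The rest converges to
    \<open>1 / 2 - pi / 4 - pi / 8 + 2 * (3 * pi / 16 - 1 / 4) = 0\<close>.\<close>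
  define R where "R n = odd_harm n * h n - odd_harm n * step_ratio n / 2
    + (step_ratio n / 2 + 1 / 2 + t n / 2 + pi / 8 * step_ratio n + pi / 8 * t n - 1 / 2 * (p n + step_ratio n)
       - 1 / 2 * (p n + step_ratio n) * t n - 1 / 4 * (p n + step_ratio n) + 2 * (3 * pi / 16 - 1 / 4))" for n
  have "(inv_central n - 1) * T_A_approx n + (2 * real n + 1) * odd_harm n
      - (inv_central n + 1) * T_A_approx (Suc n) = - R n" for n
  proof -
    define a where "a = 2 * real n + 1"
    define q where "q = inv_central n"
    define L where "L = odd_harm n"
    have a: "a > 0" "real n = (a - 1) / 2" "real (Suc n) = (a + 1) / 2"
      "inv_central (Suc n) = q * (a + 1) / a" "odd_harm (Suc n) = L + 1 / a"
      unfolding a_def q_def L_def inv_central_Suc by (simp_all add: odd_harm_def)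
    have ratio: "step_ratio n = q / a" "t n = 1 / a" "p n = q * (q / a)"
      by (simp_all add: p_def t_def step_ratio_def q_def a_def)
    show ?thesis
      unfolding T_A_approx_def R_def h_def ratio a a_def[symmetric] q_def[symmetric] L_def[symmetric]
      using a(1) by (simp add: field_simps power2_eq_square)
  qed
  moreover have "R \<longlonglongrightarrow> 0"
  proof -
    have h: "0 \<le> h n" "h n \<le> 1 / sqrt (real n)" if "0 < n" for n
      using wallis_defect_bounds[OF that] by (simp_all add: h_def p_def)
    have "(\<lambda>n. p n) \<longlonglongrightarrow> pi / 2"
      using wallis_inv_central by (simp add: p_def step_ratio_def power2_eq_square)
    moreover have "t \<longlonglongrightarrow> 0"
      unfolding t_def by real_asymp
    ultimately have "R \<longlonglongrightarrow> 0 - 0 / 2 + (0 / 2 + 1 / 2 + 0 / 2 + pi / 8 * 0 + pi / 8 * 0 - 1 / 2 * (pi / 2 + 0)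
       - 1 / 2 * (pi / 2 + 0) * 0 - 1 / 4 * (pi / 2 + 0) + 2 * (3 * pi / 16 - 1 / 4))"
      unfolding R_def
      by (intro tendsto_intros inverse_sqrt_bounded_tendsto(3)[of h] inverse_sqrt_bounded_tendsto(1,3)[of step_ratio]
          h step_ratio_bounds) simp_all
    then show ?thesis
      by simp
  qed
  ultimately show ?thesis
    using tendsto_minus[of R 0] by simp
qed

lemma T_A_approx_asymp:
  "(\<lambda>n. T_A_approx n - ((real n / 2 + pi / 16 - sqrt (pi * real n) / 4) * (ln (real n) + ln 4 + euler_mascheroni)
      + 3 * pi / 16 - sqrt (pi * real n) / 4 - 1 / 4)) \<longlonglongrightarrow> 0"
proof -
  define \<delta> where "\<delta> n = odd_harm n - log_term n" for n
  define c where "c n = inv_central n - sqrt (pi * real n)" for n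
  \<comment> \<open>The product \<open>inv_central n * \<delta> n\<close> has an unbounded factor.
    Writing it as \<open>step_ratio n * (2 * (real n * \<delta> n) + \<delta> n)\<close> uses only
    null sequences.\<close>
  have "(\<lambda>n. real n * \<delta> n - step_ratio n * (2 * (real n * \<delta> n) + \<delta> n) / 2 + pi / 8 * \<delta> n
      - (log_term n * c n / 2 + c n / 4)) \<longlonglongrightarrow> 0 - 0 * (2 * 0 + 0) / 2 + pi / 8 * 0 - (0 / 2 + 0 / 4)"
    unfolding \<delta>_def
    by (intro tendsto_intros odd_harm_asymp odd_harm_minus_log_term inverse_sqrt_bounded_tendsto(1)[of step_ratio]
        inverse_sqrt_bounded_tendsto(1,2)[of c] step_ratio_bounds)
      (simp_all add: c_def inv_central_minus_sqrt_bounds[simplified])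
  moreover have "real n * \<delta> n - step_ratio n * (2 * (real n * \<delta> n) + \<delta> n) / 2 + pi / 8 * \<delta> n
      - (log_term n * c n / 2 + c n / 4) =
    T_A_approx n - ((real n / 2 + pi / 16 - sqrt (pi * real n) / 4) * (ln (real n) + ln 4 + euler_mascheroni)
      + 3 * pi / 16 - sqrt (pi * real n) / 4 - 1 / 4)" for n
  proof -
    have "step_ratio n * (2 * (real n * \<delta> n) + \<delta> n) = step_ratio n * (2 * real n + 1) * \<delta> n"
      by (simp add: algebra_simps)
    also have "step_ratio n * (2 * real n + 1) = inv_central n"
      by (simp add: step_ratio_def add_nonneg_eq_0_iff)
    finally have "step_ratio n * (2 * (real n * \<delta> n) + \<delta> n) = inv_central n * \<delta> n" .
    moreover have "ln (real n) + ln 4 + euler_mascheroni = 2 * log_term n"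
      by (simp add: log_term_def)
    ultimately show ?thesis
      by (simp only: T_A_approx_def \<delta>_def c_def) (simp add: field_simps)
  qed
  ultimately show ?thesis
    by simp
qed

theorem theorem2p1:
  "(\<lambda>k::nat. enn2real (T_A k k) -
      ((real k / 2 + pi / 16 - sqrt (pi * real k) / 4) * (ln (real k) + ln 4 + euler_mascheroni)
        + 3 * pi / 16 - sqrt (pi * real k) / 4 - 1 / 4)) \<longlonglongrightarrow> 0"
proof -
  have "(\<lambda>k. enn2real (T_A k k) - T_A_approx k) \<longlonglongrightarrow> 0"
  proof (rule tendsto_zero_of_contraction[OF _ inv_central_ge_1 inv_central_le T_A_approx_residual])
    fix n :: nat assume "0 < n"
    from T_A_recurrence[OF this]
    show "(inv_central n + 1) * (enn2real (T_A (Suc n) (Suc n)) - T_A_approx (Suc n)) =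
      (inv_central n - 1) * (enn2real (T_A n n) - T_A_approx n) + ((inv_central n - 1) * T_A_approx n
      + (2 * real n + 1) * odd_harm n - (inv_central n + 1) * T_A_approx (Suc n))"
      by (simp only: right_diff_distrib)
  qed
  from tendsto_add[OF this T_A_approx_asymp] show ?thesis
    by (simp only: add_diff_eq diff_add_cancel add_0_right)
qed

end
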